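(* Let $(\Omega,\Sigma,\mu)$ be a complete $\sigma$-finite measure space with $\mu(\Omega)>0$ and let $E$ be an order continuous Köthe function space on $(\Omega,\Sigma,\mu)$. Then, for every nonzero (real or complex) Banach space $X$, $$n\bigl(E(X)\bigr)\leq n(X).$$
   Context: For a Banach space $X$ (real or complex), $S_X$ and $X^*$ denote its unit sphere and dual, and $L(X)$ the bounded linear operators on $X$. Put $\Pi(X)=\{(x,x^* )\in S_X\times S_{X^*}: x^*(x)=1\}$. The numerical radius of $T\in L(X)$ is $v(T)=\sup\{|x^*(Tx)|:(x,x^* )\in\Pi(X)\}$, and the numerical index of $X$ is $n(X)=\inf\{v(T): T\in L(X),\ \|T\|=1\}$. $L_0(\mu)$ is the space of (a.e.-equivalence classes of) $\Sigma$-measurable locally integrable real-valued functions on $\Omega$ (locally integrable: integrable on every set of finite measure). A Köthe function space on $(\Omega,\Sigma,\mu)$ is a linear subspace $E$ of $L_0(\mu)$ with a complete norm $\|\cdot\|_E$ such that: (i) if $|f|\leq|g|$ a.e., $g\in E$ and $f\in L_0(\mu)$, then $f\in E$ and $\|f\|_E\leq\|g\|_E$; (ii) for every $A\in\Sigma$ with $0<\mu(A)<\infty$, $\chi_A\in E$. With the a.e. pointwise order $E$ is a Banach lattice; it is order continuous if for every decreasing net $(x_\alpha)$ in $E$ with $x_\alpha\geq0$ and infimum $0$, one has $\lim\|x_\alpha\|_E=0$. A function $f:\Omega\to X$ is strongly measurable if it is the a.e. norm limit of a sequence of simple functions $\sum_{i=1}^n x_i\chi_{A_i}$ ($x_i\in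 X$, $A_i\in\Sigma$). $E(X)$ is the Banach space of (a.e. classes of) strongly measurable $f:\Omega\to X$ such that $t\mapsto\|f(t)\|_X$ belongs to $E$, with norm $\|f\|_{E(X)}=\bigl\|\,\|f(\cdot)\|_X\bigr\|_E$. *)

theory Defs
  imports "HOL-Analysis.Analysis"
begin

section \<open>Normed spaces on a carrier set, and their numerical index\<close>

text \<open>
  The points of \<open>E(X)\<close> are a.e.-classes for a measure that is a variable of the theory, so \<open>E(X)\<close>
  is not a type. The numerical index is therefore defined for normed spaces given by a carrier
  set. The scalar field \<open>'k\<close> is only ever instantiated with \<^typ>\<open>real\<close> and \<^typ>\<open>complex\<close>.
\<close>

record ('k, 'v) normed_structure =
  pts :: "'v set"
  vadd :: "'v \<Rightarrow> 'v \<Rightarrow> 'v"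
  vscale :: "'k \<Rightarrow> 'v \<Rightarrow> 'v"
  vnorm :: "'v \<Rightarrow> real"

text \<open>Values of operators and functionals outside the carrier are irrelevant.\<close>

definition bounded_operators :: "('k, 'v) normed_structure \<Rightarrow> ('v \<Rightarrow> 'v) set" where
  "bounded_operators V = {T.
     (\<forall>x\<in>pts V. T x \<in> pts V) \<and>
     (\<forall>x\<in>pts V. \<forall>y\<in>pts V. T (vadd V x y) = vadd V (T x) (T y)) \<and>
     (\<forall>c. \<forall>x\<in>pts V. T (vscale V c x) = vscale V c (T x)) \<and>
     (\<exists>C. \<forall>x\<in>pts V. vnorm V (T x) \<le> C * vnorm V x)}"

definition dual_space :: "('k::real_normed_field, 'v) normed_structure \<Rightarrow> ('v \<Rightarrow> 'k) set" where
  "dual_space V = {\<phi>.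
     (\<forall>x\<in>pts V. \<forall>y\<in>pts V. \<phi> (vadd V x y) = \<phi> x + \<phi> y) \<and>
     (\<forall>c. \<forall>x\<in>pts V. \<phi> (vscale V c x) = c * \<phi> x) \<and>
     (\<exists>C. \<forall>x\<in>pts V. norm (\<phi> x) \<le> C * vnorm V x)}"

definition operator_norm :: "('k, 'v) normed_structure \<Rightarrow> ('v \<Rightarrow> 'v) \<Rightarrow> real" where
  "operator_norm V T = (SUP x\<in>{x\<in>pts V. vnorm V x \<le> 1}. vnorm V (T x))"

definition dual_norm ::
    "('k::real_normed_field, 'v) normed_structure \<Rightarrow> ('v \<Rightarrow> 'k) \<Rightarrow> real" where
  "dual_norm V \<phi> = (SUP x\<in>{x\<in>pts V. vnorm V x \<le> 1}. norm (\<phi> x))"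

definition state_pairs ::
    "('k::real_normed_field, 'v) normed_structure \<Rightarrow> ('v \<times> ('v \<Rightarrow> 'k)) set" where
  "state_pairs V = {(x, \<phi>). x \<in> pts V \<and> vnorm V x = 1 \<and>
     \<phi> \<in> dual_space V \<and> dual_norm V \<phi> = 1 \<and> \<phi> x = 1}"

definition numerical_radius ::
    "('k::real_normed_field, 'v) normed_structure \<Rightarrow> ('v \<Rightarrow> 'v) \<Rightarrow> real" where
  "numerical_radius V T = (SUP (x, \<phi>)\<in>state_pairs V. norm (\<phi> (T x)))"

definition numerical_index :: "('k::real_normed_field, 'v) normed_structure \<Rightarrow> real" where
  "numerical_index V =
     (INF T\<in>{T\<in>bounded_operators V. operator_norm V T = 1}. numerical_radius V T)"

text \<open>
  A complex Banach space is a real one (on the same type, with the same norm) together with a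
  complex scalar multiplication \<open>sc\<close> that extends the real one and makes the norm homogeneous.
\<close>

locale complex_banach = vector_space sc
  for sc :: "complex \<Rightarrow> 'a::banach \<Rightarrow> 'a" +
  assumes sc_of_real: "sc (of_real r) x = r *\<^sub>R x"
    and norm_sc: "norm (sc c x) = cmod c * norm x"

definition type_space ::
    "('k \<Rightarrow> 'a::real_normed_vector \<Rightarrow> 'a) \<Rightarrow> ('k, 'a) normed_structure" where
  "type_space sc = \<lparr>pts = UNIV, vadd = (+), vscale = sc, vnorm = norm\<rparr>"


section \<open>Koethe function spaces\<close>

definition L0 :: "'w measure \<Rightarrow> ('w \<Rightarrow> real) set" where
  "L0 M = {f. f \<in> borel_measurable M \<and>
     (\<forall>A\<in>sets M. emeasure M A < \<infinity> \<longrightarrow> set_integrable M A f)}"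

text \<open>
  \<open>E\<close> is given by the set of all representatives of its elements and \<open>N\<close> is its norm, read on
  representatives. Invariance of \<open>E\<close> and \<open>N\<close> under a.e. equality (among measurable functions)
  follows from \<open>solid\<close>.
\<close>

locale koethe_function_space =
  fixes M :: "'w measure" and E :: "('w \<Rightarrow> real) set" and N :: "('w \<Rightarrow> real) \<Rightarrow> real"
  assumes subset_L0: "E \<subseteq> L0 M"
    and zero_mem: "(\<lambda>t. 0) \<in> E"
    and add_mem: "\<lbrakk>f \<in> E; g \<in> E\<rbrakk> \<Longrightarrow> (\<lambda>t. f t + g t) \<in> E"
    and scale_mem: "f \<in> E \<Longrightarrow> (\<lambda>t. c * f t) \<in> E"
    and norm_eq_zero: "f \<in> E \<Longrightarrow> N f = 0 \<longleftrightarrow> (AE t in M. f t = 0)"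
    and norm_scale: "f \<in> E \<Longrightarrow> N (\<lambda>t. c * f t) = \<bar>c\<bar> * N f"
    and norm_triangle: "\<lbrakk>f \<in> E; g \<in> E\<rbrakk> \<Longrightarrow> N (\<lambda>t. f t + g t) \<le> N f + N g"
    and complete: "\<lbrakk>\<And>n::nat. u n \<in> E;
        \<forall>e>0. \<exists>k. \<forall>m\<ge>k. \<forall>n\<ge>k. N (\<lambda>t. u m t - u n t) < e\<rbrakk>
        \<Longrightarrow> \<exists>f\<in>E. (\<lambda>n. N (\<lambda>t. u n t - f t)) \<longlonglongrightarrow> 0"
    and solid: "\<lbrakk>AE t in M. \<bar>f t\<bar> \<le> \<bar>g t\<bar>; g \<in> E; f \<in> L0 M\<rbrakk> \<Longrightarrow> f \<in> E \<and> N f \<le> N g"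
    and indicator_mem: "\<lbrakk>A \<in> sets M; 0 < emeasure M A; emeasure M A < \<infinity>\<rbrakk>
        \<Longrightarrow> (indicator A :: 'w \<Rightarrow> real) \<in> E"

definition directed_by :: "'i set \<Rightarrow> ('i \<Rightarrow> 'i \<Rightarrow> bool) \<Rightarrow> bool" where
  "directed_by I le \<longleftrightarrow> I \<noteq> {} \<and> (\<forall>i\<in>I. le i i) \<and>
     (\<forall>i\<in>I. \<forall>j\<in>I. \<forall>k\<in>I. le i j \<longrightarrow> le j k \<longrightarrow> le i k) \<and>
     (\<forall>i\<in>I. \<forall>j\<in>I. \<exists>k\<in>I. le i k \<and> le j k)"

definition decreasing_null_net ::
    "'w measure \<Rightarrow> ('w \<Rightarrow> real) set \<Rightarrow> 'i set \<Rightarrow> ('i \<Rightarrow> 'i \<Rightarrow> bool) \<Rightarrow> ('i \<Rightarrow> 'w \<Rightarrow> real) \<Rightarrow> bool" where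
  "decreasing_null_net M E I le x \<longleftrightarrow> directed_by I le \<and>
     (\<forall>i\<in>I. x i \<in> E \<and> (AE t in M. 0 \<le> x i t)) \<and>
     (\<forall>i\<in>I. \<forall>j\<in>I. le i j \<longrightarrow> (AE t in M. x j t \<le> x i t)) \<and>
     (\<forall>g\<in>E. (\<forall>i\<in>I. AE t in M. g t \<le> x i t) \<longrightarrow> (AE t in M. g t \<le> 0))"

text \<open>
  A definition cannot quantify over the type of the index set. Nets indexed by sets of functions
  suffice, since a decreasing net may be re-indexed by its range; lemma
  \<open>order_continuousD\<close> below gives the property for an arbitrary index type.
\<close>

definition order_continuous ::
    "'w measure \<Rightarrow> ('w \<Rightarrow> real) set \<Rightarrow> (('w \<Rightarrow> real) \<Rightarrow> real) \<Rightarrow> bool" where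
  "order_continuous M E N \<longleftrightarrow>
     (\<forall>(I :: ('w \<Rightarrow> real) set) le x. decreasing_null_net M E I le x \<longrightarrow>
        (\<forall>e>0. \<exists>i0\<in>I. \<forall>i\<in>I. le i0 i \<longrightarrow> \<bar>N (x i)\<bar> < e))"

lemma (in koethe_function_space) order_continuousD:
  fixes I :: "'i set" and x :: "'i \<Rightarrow> 'w \<Rightarrow> real"
  assumes oc: "order_continuous M E N" and net: "decreasing_null_net M E I le x" and "e > 0"
  shows "\<exists>i0\<in>I. \<forall>i\<in>I. le i0 i \<longrightarrow> \<bar>N (x i)\<bar> < e"
proof -
  note net' = net[unfolded decreasing_null_net_def]
  note dir = net'[THEN conjunct1, unfolded directed_by_def]
  define ge where "ge = (\<lambda>f g :: 'w \<Rightarrow> real. AE t in M. g t \<le> f t)"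
  have dec: "le i j \<Longrightarrow> ge (x i) (x j)" if "i \<in> I" "j \<in> I" for i j
    using net' that unfolding ge_def by blast
  have trans: "ge f h" if "ge f g" "ge g h" for f g h
    using that unfolding ge_def by eventually_elim simp
  have "directed_by (x ` I) ge"
    unfolding directed_by_def
  proof (intro conjI ballI impI)
    show "x ` I \<noteq> {}" using dir by blast
    show "ge f f" for f by (simp add: ge_def)
    show "ge f h" if "ge f g" "ge g h" for f g h using that by (rule trans)
    fix f g assume "f \<in> x ` I" "g \<in> x ` I"
    then obtain i j where ij: "f = x i" "g = x j" "i \<in> I" "j \<in> I" by auto
    then obtain k where "k \<in> I" "le i k" "le j k"
      using dir by blast
    then show "\<exists>h\<in>x ` I. ge f h \<and> ge g h" using ij dec by blast
  qed
  moreover have "\<forall>f\<in>x ` I. f \<in> E \<and> (AE t in M. 0 \<le> f t)" using net' by blast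
  moreover have "\<forall>f\<in>x ` I. \<forall>g\<in>x ` I. ge f g \<longrightarrow> (AE t in M. g t \<le> f t)" by (simp add: ge_def)
  moreover have "\<forall>g\<in>E. (\<forall>f\<in>x ` I. AE t in M. g t \<le> f t) \<longrightarrow> (AE t in M. g t \<le> 0)"
    using net' by simp
  ultimately have "decreasing_null_net M E (x ` I) ge (\<lambda>f. f)"
    unfolding decreasing_null_net_def by (intro conjI)
  then obtain i0 where i0: "i0 \<in> I" "\<And>i. \<lbrakk>i \<in> I; ge (x i0) (x i)\<rbrakk> \<Longrightarrow> \<bar>N (x i)\<bar> < e"
    using oc[unfolded order_continuous_def, rule_format, of "x ` I" ge "\<lambda>f. f" e] \<open>e > 0\<close> by auto
  have "\<bar>N (x i)\<bar> < e" if "i \<in> I" "le i0 i" for i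
    using i0 dec that by blast
  then show ?thesis using i0(1) by blast
qed


section \<open>The space \<open>E(X)\<close>\<close>

definition strongly_measurable ::
    "'w measure \<Rightarrow> ('w \<Rightarrow> 'a::real_normed_vector) \<Rightarrow> bool" where
  "strongly_measurable M f \<longleftrightarrow>
     (\<exists>s. (\<forall>n. simple_function M (s n)) \<and> (AE t in M. (\<lambda>n. s n t) \<longlonglongrightarrow> f t))"

definition koethe_bochner_fns ::
    "'w measure \<Rightarrow> ('w \<Rightarrow> real) set \<Rightarrow> ('w \<Rightarrow> 'a::real_normed_vector) set" where
  "koethe_bochner_fns M E = {f. strongly_measurable M f \<and> (\<lambda>t. norm (f t)) \<in> E}"

definition ae_rel :: "'w measure \<Rightarrow> ('w \<Rightarrow> 'a) set \<Rightarrow> (('w \<Rightarrow> 'a) \<times> ('w \<Rightarrow> 'a)) set" where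
  "ae_rel M F = {(f, g). f \<in> F \<and> g \<in> F \<and> (AE t in M. f t = g t)}"

definition koethe_bochner_space ::
    "'w measure \<Rightarrow> ('w \<Rightarrow> real) set \<Rightarrow> (('w \<Rightarrow> real) \<Rightarrow> real) \<Rightarrow>
     ('k \<Rightarrow> 'a::real_normed_vector \<Rightarrow> 'a) \<Rightarrow> ('k, ('w \<Rightarrow> 'a) set) normed_structure" where
  "koethe_bochner_space M E N sc =
    (let F = koethe_bochner_fns M E; R = ae_rel M F in
      \<lparr>pts = F // R,
       vadd = (\<lambda>A B. \<Union>f\<in>A. \<Union>g\<in>B. R `` {\<lambda>t. f t + g t}),
       vscale = (\<lambda>c A. \<Union>f\<in>A. R `` {\<lambda>t. sc c (f t)}),
       vnorm = (\<lambda>A. the_elem ((\<lambda>f. N (\<lambda>t. norm (f t))) ` A))\<rparr>)"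

text \<open>The operations are computed on representatives.\<close>

lemma strongly_measurable_norm:
  assumes M: "complete_measure M" and f: "strongly_measurable M f"
  shows "(\<lambda>t. norm (f t)) \<in> borel_measurable M"
proof -
  obtain s where s: "\<And>n. simple_function M (s n)" "AE t in M. (\<lambda>n. s n t) \<longlonglongrightarrow> f t"
    using f unfolding strongly_measurable_def by auto
  have "(\<lambda>t. norm (s n t)) \<in> borel_measurable M" for n
    by (rule borel_measurable_simple_function[OF simple_function_compose1[OF s(1)]])
  then have meas: "(\<lambda>t. lim (\<lambda>n. norm (s n t))) \<in> borel_measurable M"
    by (rule borel_measurable_lim_metric)
  have ae: "AE t in M. lim (\<lambda>n. norm (s n t)) = norm (f t)"
    using s(2) by eventually_elim (rule limI, rule tendsto_norm)
  show ?thesis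
  proof (rule measurableI)
    fix B :: "real set" assume B: "B \<in> sets borel"
    show "(\<lambda>t. norm (f t)) -` B \<inter> space M \<in> sets M"
    proof (rule complete_measure.in_sets_AE[OF M])
      show "(\<lambda>t. lim (\<lambda>n. norm (s n t))) -` B \<inter> space M \<in> sets M"
        using meas B by (rule measurable_sets)
      show "AE t in M. t \<in> (\<lambda>t. lim (\<lambda>n. norm (s n t))) -` B \<inter> space M \<longleftrightarrow>
              t \<in> (\<lambda>t. norm (f t)) -` B \<inter> space M"
        using ae by eventually_elim simp
    qed auto
  qed simp
qed

lemma equiv_ae_rel: "equiv F (ae_rel M F)"
proof (rule equivI)
  show "ae_rel M F \<subseteq> F \<times> F" by (auto simp: ae_rel_def)
  show "refl_on F (ae_rel M F)" by (auto simp: ae_rel_def refl_on_def)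
  show "sym (ae_rel M F)" by (auto simp: ae_rel_def sym_def eq_commute)
  show "trans (ae_rel M F)"
  proof (rule transI)
    fix f g h assume fg: "(f, g) \<in> ae_rel M F" and gh: "(g, h) \<in> ae_rel M F"
    then have "AE t in M. f t = g t" "AE t in M. g t = h t" by (auto simp: ae_rel_def)
    then have "AE t in M. f t = h t" by eventually_elim simp
    then show "(f, h) \<in> ae_rel M F" using fg gh by (auto simp: ae_rel_def)
  qed
qed

context koethe_function_space
begin

abbreviation cls :: "('w \<Rightarrow> 'a::real_normed_vector) \<Rightarrow> ('w \<Rightarrow> 'a) set" where
  "cls f \<equiv> ae_rel M (koethe_bochner_fns M E) `` {f}"

lemma N_cong:
  assumes "f \<in> E" "g \<in> E" "AE t in M. f t = g t"
  shows "N f = N g"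
proof (rule antisym)
  have "AE t in M. \<bar>f t\<bar> \<le> \<bar>g t\<bar>" "AE t in M. \<bar>g t\<bar> \<le> \<bar>f t\<bar>"
    using assms(3) by auto
  moreover have "f \<in> L0 M" "g \<in> L0 M" using assms subset_L0 by auto
  ultimately show "N f \<le> N g" "N g \<le> N f" using solid assms by simp_all
qed

lemma vnorm_cls:
  assumes "f \<in> koethe_bochner_fns M E"
  shows "vnorm (koethe_bochner_space M E N sc) (cls f) = N (\<lambda>t. norm (f t))"
proof -
  have "N (\<lambda>t. norm (g t)) = N (\<lambda>t. norm (f t))" if "g \<in> cls f" for g
  proof (rule N_cong)
    have "AE t in M. f t = g t" using that by (simp add: ae_rel_def)
    then show "AE t in M. norm (g t) = norm (f t)" by eventually_elim simp
  qed (use that in \<open>auto simp: ae_rel_def koethe_bochner_fns_def\<close>)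
  then have "(\<lambda>g. N (\<lambda>t. norm (g t))) ` cls f = (\<lambda>_. N (\<lambda>t. norm (f t))) ` cls f"
    by (rule image_cong[OF refl])
  also have "f \<in> cls f" using assms by (simp add: ae_rel_def)
  then have "(\<lambda>_. N (\<lambda>t. norm (f t))) ` cls f = {N (\<lambda>t. norm (f t))}"
    by (rule image_constant)
  finally have "(\<lambda>g. N (\<lambda>t. norm (g t))) ` cls f = {N (\<lambda>t. norm (f t))}" .
  then show ?thesis by (simp add: koethe_bochner_space_def Let_def)
qed

lemma koethe_bochner_fns_add:
  fixes f g :: "'w \<Rightarrow> 'a::real_normed_vector"
  assumes M: "complete_measure M" and f: "f \<in> koethe_bochner_fns M E"
    and g: "g \<in> koethe_bochner_fns M E"
  shows "(\<lambda>t. f t + g t) \<in> koethe_bochner_fns M E"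
proof -
  have sm: "strongly_measurable M (\<lambda>t. f t + g t)"
  proof -
    obtain s r where s: "\<And>n. simple_function M (s n)" "AE t in M. (\<lambda>n. s n t) \<longlonglongrightarrow> f t"
      and r: "\<And>n. simple_function M (r n)" "AE t in M. (\<lambda>n. r n t) \<longlonglongrightarrow> g t"
      using f g unfolding koethe_bochner_fns_def strongly_measurable_def by auto
    have "simple_function M (\<lambda>t. s n t + r n t)" for n
      using s(1) r(1) by (rule simple_function_compose2)
    moreover have "AE t in M. (\<lambda>n. s n t + r n t) \<longlonglongrightarrow> f t + g t"
      using s(2) r(2) by eventually_elim (rule tendsto_add)
    ultimately show ?thesis
      unfolding strongly_measurable_def by (intro exI[of _ "\<lambda>n t. s n t + r n t"]) auto
  qed
  let ?h = "\<lambda>t. norm (f t) + norm (g t)"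
  have h: "?h \<in> E" using f g by (simp add: koethe_bochner_fns_def add_mem)
  have meas: "(\<lambda>t. norm (f t + g t)) \<in> borel_measurable M"
    using M sm by (rule strongly_measurable_norm)
  have "set_integrable M A (\<lambda>t. norm (f t + g t))"
    if A: "A \<in> sets M" "emeasure M A < \<infinity>" for A
  proof -
    have int: "integrable M (\<lambda>t. indicator A t *\<^sub>R ?h t)"
      using h subset_L0 A by (auto simp: L0_def set_integrable_def)
    show ?thesis
      unfolding set_integrable_def
    proof (rule Bochner_Integration.integrable_bound[OF int])
      show "(\<lambda>t. indicator A t *\<^sub>R norm (f t + g t)) \<in> borel_measurable M"
        using meas A(1) by measurable
    qed (auto simp: indicator_def norm_triangle_ineq)
  qed
  with meas have L0: "(\<lambda>t. norm (f t + g t)) \<in> L0 M" by (simp add: L0_def)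
  have ae: "AE t in M. \<bar>norm (f t + g t)\<bar> \<le> \<bar>?h t\<bar>" by (auto simp: norm_triangle_ineq)
  have "(\<lambda>t. norm (f t + g t)) \<in> E"
    by (rule conjunct1[OF solid[OF ae h L0]])
  then have "strongly_measurable M (\<lambda>t. f t + g t) \<and> (\<lambda>t. norm (f t + g t)) \<in> E"
    by (rule conjI[OF sm])
  then show ?thesis by (simp only: koethe_bochner_fns_def mem_Collect_eq)
qed

lemma vadd_cls:
  fixes f g :: "'w \<Rightarrow> 'a::real_normed_vector"
  assumes M: "complete_measure M" and f: "f \<in> koethe_bochner_fns M E"
    and g: "g \<in> koethe_bochner_fns M E"
  shows "vadd (koethe_bochner_space M E N sc) (cls f) (cls g) = cls (\<lambda>t. f t + g t)"
proof -
  have "cls (\<lambda>t. f' t + g' t) = cls (\<lambda>t. f t + g t)" if fg: "f' \<in> cls f" "g' \<in> cls g" for f' g'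
  proof (rule equiv_class_eq[OF equiv_ae_rel])
    have mem: "f' \<in> koethe_bochner_fns M E" "g' \<in> koethe_bochner_fns M E"
      and ae: "AE t in M. f t = f' t" "AE t in M. g t = g' t"
      using fg by (auto simp: ae_rel_def)
    from ae have "AE t in M. f' t + g' t = f t + g t" by eventually_elim simp
    then show "((\<lambda>t. f' t + g' t), (\<lambda>t. f t + g t)) \<in> ae_rel M (koethe_bochner_fns M E)"
      using koethe_bochner_fns_add[OF M] mem f g by (auto simp: ae_rel_def)
  qed
  then have "(\<Union>f'\<in>cls f. \<Union>g'\<in>cls g. cls (\<lambda>t. f' t + g' t)) =
      (\<Union>f'\<in>cls f. \<Union>g'\<in>cls g. cls (\<lambda>t. f t + g t))"
    by (intro SUP_cong refl)
  moreover have "cls f \<noteq> {}" "cls g \<noteq> {}"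
    using equiv_class_self[OF equiv_ae_rel] f g by blast+
  ultimately have "(\<Union>f'\<in>cls f. \<Union>g'\<in>cls g. cls (\<lambda>t. f' t + g' t)) = cls (\<lambda>t. f t + g t)"
    by (simp only: UN_constant if_False)
  then show ?thesis by (simp add: koethe_bochner_space_def Let_def)
qed

lemma koethe_bochner_fns_scale:
  fixes sc :: "'k::real_normed_field \<Rightarrow> 'a::real_normed_vector \<Rightarrow> 'a"
  assumes sc: "\<And>c x. norm (sc c x) = norm c * norm x" "\<And>c x y. sc c (x - y) = sc c x - sc c y"
    and f: "f \<in> koethe_bochner_fns M E"
  shows "(\<lambda>t. sc c (f t)) \<in> koethe_bochner_fns M E"
proof -
  obtain s where s: "\<And>n. simple_function M (s n)" "AE t in M. (\<lambda>n. s n t) \<longlonglongrightarrow> f t"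
    using f unfolding koethe_bochner_fns_def strongly_measurable_def by auto
  have "simple_function M (\<lambda>t. sc c (s n t))" for n
    using s(1) by (rule simple_function_compose1)
  moreover have "AE t in M. (\<lambda>n. sc c (s n t)) \<longlonglongrightarrow> sc c (f t)"
    using s(2)
  proof eventually_elim
    case (elim t)
    have "(\<lambda>n. norm c * norm (s n t - f t)) \<longlonglongrightarrow> norm c * 0"
      using elim by (intro tendsto_mult tendsto_const) (simp add: LIM_zero_iff tendsto_norm_zero)
    then have "(\<lambda>n. norm (sc c (s n t) - sc c (f t))) \<longlonglongrightarrow> 0"
      by (simp only: sc(1) mult_zero_right flip: sc(2))
    then show ?case
      by (rule LIM_zero_cancel[OF tendsto_norm_zero_cancel])
  qed
  ultimately have "strongly_measurable M (\<lambda>t. sc c (f t))"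
    unfolding strongly_measurable_def by (intro exI[of _ "\<lambda>n t. sc c (s n t)"]) auto
  then show ?thesis
    using f scale_mem[of "\<lambda>t. norm (f t)" "norm c"] by (simp add: koethe_bochner_fns_def sc(1))
qed

lemma vscale_cls:
  fixes sc :: "'k::real_normed_field \<Rightarrow> 'a::real_normed_vector \<Rightarrow> 'a"
  assumes sc: "\<And>c x. norm (sc c x) = norm c * norm x" "\<And>c x y. sc c (x - y) = sc c x - sc c y"
    and f: "f \<in> koethe_bochner_fns M E"
  shows "vscale (koethe_bochner_space M E N sc) c (cls f) = cls (\<lambda>t. sc c (f t))"
proof -
  have "cls (\<lambda>t. sc c (g t)) = cls (\<lambda>t. sc c (f t))" if g: "g \<in> cls f" for g
  proof (rule equiv_class_eq[OF equiv_ae_rel])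
    have "g \<in> koethe_bochner_fns M E" "AE t in M. f t = g t" using g by (auto simp: ae_rel_def)
    moreover from this(2) have "AE t in M. sc c (g t) = sc c (f t)" by eventually_elim simp
    ultimately show
      "((\<lambda>t. sc c (g t)), (\<lambda>t. sc c (f t))) \<in> ae_rel M (koethe_bochner_fns M E)"
      using koethe_bochner_fns_scale[OF sc] f by (auto simp: ae_rel_def)
  qed
  then have "(\<Union>g\<in>cls f. cls (\<lambda>t. sc c (g t))) = (\<Union>g\<in>cls f. cls (\<lambda>t. sc c (f t)))"
    by (intro SUP_cong refl)
  moreover have "cls f \<noteq> {}"
    using equiv_class_self[OF equiv_ae_rel] f by blast
  ultimately have "(\<Union>g\<in>cls f. cls (\<lambda>t. sc c (g t))) = cls (\<lambda>t. sc c (f t))"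
    by (simp only: UN_constant if_False)
  then show ?thesis by (simp add: koethe_bochner_space_def Let_def)
qed

end

end

theory Submission
  imports Defs
begin

text \<open>
  An operator \<open>T\<close> on \<open>X\<close> acts pointwise on \<open>E(X)\<close>, by \<open>(S f)(t) = T (f t)\<close>, and \<open>\<parallel>S\<parallel> = \<parallel>T\<parallel>\<close>. So it is
  enough to show \<open>v(S) \<le> v(T)\<close>. The obvious way, decomposing a functional on \<open>E(X)\<close> into functionals
  on the fibres, needs a representation of the dual of \<open>E(X)\<close>. It is avoided by expressing the
  numerical radius through norms alone, as Lumer did: \<open>v(T)\<close> controls the first-order growth of
  \<open>\<parallel>y + c T y\<parallel>\<close> as \<open>c \<longlongrightarrow> 0\<close>, namely
    \<open>(1 - \<bar>c\<bar> v(T)) \<parallel>y + c T y\<parallel> \<le> (1 + \<bar>c\<bar>\<^sup>2 \<parallel>T\<parallel>\<^sup>2) \<parallel>y\<parallel>\<close>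
  (\<open>norm_perturbed_identity_le\<close>). Unlike a statement about functionals, this one can be applied with
  \<open>y = f t\<close> at every point \<open>t\<close>, and since the norm of \<open>E\<close> is monotone it passes to \<open>S\<close> and \<open>f\<close>
  (\<open>vnorm_perturbed_lift_operator_le\<close>). Any state \<open>(f, \<phi>)\<close> of \<open>E(X)\<close> satisfies
  \<open>\<bar>1 + c \<phi>(S f)\<bar> \<le> \<parallel>f + c S f\<parallel>\<close>; choosing the argument of \<open>c\<close> so that \<open>c \<phi>(S f) \<ge> 0\<close> and letting
  \<open>c \<longlongrightarrow> 0\<close> gives \<open>\<bar>\<phi>(S f)\<bar> \<le> v(T)\<close> (\<open>norm_state_lift_operator_le\<close>).

  Lumer's estimate rests on the existence of a norming functional at every unit vector of \<open>X\<close>.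
  Norming functionals are also needed on \<open>E(X)\<close>: its numerical radii are suprema over states, and
  such a supremum is meaningful only if there is at least one. The Hahn--Banach theorem is
  therefore proved for spaces given by a carrier set, which covers \<open>X\<close> and \<open>E(X)\<close> at once.
\<close>

section \<open>Seminormed spaces on a carrier set\<close>

locale seminormed_space =
  fixes V :: "('k::real_normed_field, 'v) normed_structure"
  assumes vadd_closed: "x \<in> pts V \<Longrightarrow> y \<in> pts V \<Longrightarrow> vadd V x y \<in> pts V"
    and vscale_closed: "x \<in> pts V \<Longrightarrow> vscale V c x \<in> pts V"
    and vadd_assoc: "x \<in> pts V \<Longrightarrow> y \<in> pts V \<Longrightarrow> z \<in> pts V \<Longrightarrow>
      vadd V (vadd V x y) z = vadd V x (vadd V y z)"
    and vadd_commute: "x \<in> pts V \<Longrightarrow> y \<in> pts V \<Longrightarrow> vadd V x y = vadd V y x"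
    and vadd_zero: "x \<in> pts V \<Longrightarrow> y \<in> pts V \<Longrightarrow> vadd V x (vscale V 0 y) = x"
    and vscale_vadd: "x \<in> pts V \<Longrightarrow> y \<in> pts V \<Longrightarrow>
      vscale V c (vadd V x y) = vadd V (vscale V c x) (vscale V c y)"
    and vscale_add: "x \<in> pts V \<Longrightarrow> vscale V (c + d) x = vadd V (vscale V c x) (vscale V d x)"
    and vscale_vscale: "x \<in> pts V \<Longrightarrow> vscale V c (vscale V d x) = vscale V (c * d) x"
    and vscale_one: "x \<in> pts V \<Longrightarrow> vscale V 1 x = x"
    and vnorm_triangle: "x \<in> pts V \<Longrightarrow> y \<in> pts V \<Longrightarrow>
      vnorm V (vadd V x y) \<le> vnorm V x + vnorm V y"
    and vnorm_vscale: "x \<in> pts V \<Longrightarrow> vnorm V (vscale V c x) = norm c * vnorm V x"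
begin

lemma vadd_minus: "x \<in> pts V \<Longrightarrow> vadd V (vscale V (-1) x) x = vscale V 0 x"
  using vscale_add[of x "-1" 1] by (simp add: vscale_one)

lemma vadd_minus_cancel:
  assumes "x \<in> pts V" "y \<in> pts V"
  shows "vadd V (vadd V x y) (vscale V (-1) y) = x"
  using assms vadd_minus[of y] vadd_commute[of y "vscale V (-1) y"]
  by (simp add: vadd_assoc vadd_zero vscale_closed)

lemma vnorm_nonneg:
  assumes x: "x \<in> pts V"
  shows "0 \<le> vnorm V x"
proof -
  have "0 = vnorm V (vscale V 0 x)" using x by (simp add: vnorm_vscale)
  also have "\<dots> \<le> vnorm V (vscale V (-1) x) + vnorm V x"
    using vnorm_triangle[of "vscale V (-1) x" x] x by (simp add: vadd_minus vscale_closed)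
  finally show ?thesis using x by (simp add: vnorm_vscale)
qed

lemma vnorm_normalize:
  assumes "x \<in> pts V" "vnorm V x \<noteq> 0"
  shows "vnorm V (vscale V (of_real (1 / vnorm V x)) x) = 1"
  using assms vnorm_nonneg[of x] by (simp add: vnorm_vscale norm_divide)

text \<open>
  Operator norms and dual norms are both suprema over the unit ball of an absolutely homogeneous
  function; this is the bound that such a supremum gives on the whole space.
\<close>

lemma homogeneous_le_SUP_ball:
  fixes g :: "'v \<Rightarrow> real"
  assumes hom: "\<And>r x. x \<in> pts V \<Longrightarrow> g (vscale V (of_real r) x) = \<bar>r\<bar> * g x"
    and bound: "\<And>x. x \<in> pts V \<Longrightarrow> g x \<le> C * vnorm V x" and x: "x \<in> pts V"
  shows "g x \<le> (SUP u\<in>{u\<in>pts V. vnorm V u \<le> 1}. g u) * vnorm V x"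
proof (cases "vnorm V x = 0")
  case True
  then show ?thesis using bound[OF x] by simp
next
  case False
  let ?u = "vscale V (of_real (1 / vnorm V x)) x"
  have pos: "vnorm V x > 0" using False vnorm_nonneg[OF x] by simp
  have "g y \<le> \<bar>C\<bar>" if y: "y \<in> pts V" "vnorm V y \<le> 1" for y
  proof -
    have "C * vnorm V y \<le> \<bar>C\<bar> * 1"
      using y vnorm_nonneg[of y] by (intro mult_mono) auto
    then show ?thesis using bound[OF y(1)] by simp
  qed
  then have bdd: "bdd_above (g ` {u\<in>pts V. vnorm V u \<le> 1})"
    by (intro bdd_aboveI[of _ "\<bar>C\<bar>"]) auto
  have "?u \<in> {u\<in>pts V. vnorm V u \<le> 1}"
    using vnorm_normalize[OF x False] vscale_closed[OF x] by simp
  then have "g ?u \<le> (SUP u\<in>{u\<in>pts V. vnorm V u \<le> 1}. g u)"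
    using bdd by (rule cSUP_upper)
  moreover have "g ?u = g x / vnorm V x" using pos by (simp only: hom[OF x]) simp
  ultimately show ?thesis using pos by (simp add: divide_le_eq)
qed

lemma vnorm_le_operator_norm:
  assumes T: "T \<in> bounded_operators V" and x: "x \<in> pts V"
  shows "vnorm V (T x) \<le> operator_norm V T * vnorm V x"
proof -
  obtain C where "\<forall>x\<in>pts V. vnorm V (T x) \<le> C * vnorm V x"
    using T unfolding bounded_operators_def by blast
  then show ?thesis
    unfolding operator_norm_def
    using T x by (intro homogeneous_le_SUP_ball) (auto simp: bounded_operators_def vnorm_vscale)
qed

lemma norm_le_dual_norm:
  assumes \<phi>: "\<phi> \<in> dual_space V" and x: "x \<in> pts V"
  shows "norm (\<phi> x) \<le> dual_norm V \<phi> * vnorm V x"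
proof -
  obtain C where "\<forall>x\<in>pts V. norm (\<phi> x) \<le> C * vnorm V x"
    using \<phi> unfolding dual_space_def by blast
  then show ?thesis
    unfolding dual_norm_def
    using \<phi> x by (intro homogeneous_le_SUP_ball) (auto simp: dual_space_def norm_mult)
qed

lemma state_le_vnorm:
  assumes "(x, \<phi>) \<in> state_pairs V" "y \<in> pts V"
  shows "norm (\<phi> y) \<le> vnorm V y"
  using norm_le_dual_norm[of \<phi> y] assms by (auto simp: state_pairs_def)

lemma state_pairsI:
  assumes x: "x \<in> pts V" "vnorm V x = 1" "\<phi> x = 1"
    and add: "\<And>x y. x \<in> pts V \<Longrightarrow> y \<in> pts V \<Longrightarrow> \<phi> (vadd V x y) = \<phi> x + \<phi> y"
    and scale: "\<And>c x. x \<in> pts V \<Longrightarrow> \<phi> (vscale V c x) = c * \<phi> x"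
    and bound: "\<And>x. x \<in> pts V \<Longrightarrow> norm (\<phi> x) \<le> vnorm V x"
  shows "(x, \<phi>) \<in> state_pairs V"
proof -
  have "dual_norm V \<phi> = 1"
    unfolding dual_norm_def
  proof (rule cSup_eq_maximum)
    show "1 \<in> (\<lambda>x. norm (\<phi> x)) ` {x \<in> pts V. vnorm V x \<le> 1}"
      using x by (intro image_eqI[of _ _ x]) auto
  qed (use bound in force)
  moreover have "\<phi> \<in> dual_space V"
    unfolding dual_space_def using add scale bound by (auto intro!: exI[of _ 1])
  ultimately show ?thesis using x by (simp add: state_pairs_def)
qed

lemma norm_state_le_numerical_radius:
  assumes T: "T \<in> bounded_operators V" and s: "(x, \<phi>) \<in> state_pairs V"
  shows "norm (\<phi> (T x)) \<le> numerical_radius V T"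
proof -
  have "norm (\<psi> (T y)) \<le> operator_norm V T" if s: "(y, \<psi>) \<in> state_pairs V" for y \<psi>
  proof -
    have "y \<in> pts V" "vnorm V y = 1" using s by (auto simp: state_pairs_def)
    moreover from this have "T y \<in> pts V" using T by (simp add: bounded_operators_def)
    ultimately show ?thesis
      using state_le_vnorm[OF s, of "T y"] vnorm_le_operator_norm[OF T, of y] by simp
  qed
  then have "bdd_above ((\<lambda>(x, \<phi>). norm (\<phi> (T x))) ` state_pairs V)"
    by (intro bdd_aboveI[of _ "operator_norm V T"]) auto
  then have "(\<lambda>(x, \<phi>). norm (\<phi> (T x))) (x, \<phi>) \<le> numerical_radius V T"
    unfolding numerical_radius_def using s by (rule cSUP_upper2) simp
  then show ?thesis by simp
qed

lemma numerical_radius_nonneg: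
  assumes "T \<in> bounded_operators V" "state_pairs V \<noteq> {}"
  shows "0 \<le> numerical_radius V T"
proof -
  obtain x \<phi> where "(x, \<phi>) \<in> state_pairs V" using assms(2) by auto
  from norm_state_le_numerical_radius[OF assms(1) this] show ?thesis
    by (rule order_trans[OF norm_ge_zero])
qed


section \<open>The Hahn--Banach theorem\<close>

definition sublinear :: "('v \<Rightarrow> real) \<Rightarrow> bool" where
  "sublinear q \<longleftrightarrow>
     (\<forall>x\<in>pts V. \<forall>y\<in>pts V. q (vadd V x y) \<le> q x + q y) \<and>
     (\<forall>x\<in>pts V. \<forall>r\<ge>0. q (vscale V (of_real r) x) \<le> r * q x)"

lemma sublinear_vadd: "sublinear q \<Longrightarrow> x \<in> pts V \<Longrightarrow> y \<in> pts V \<Longrightarrow> q (vadd V x y) \<le> q x + q y"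
  by (simp add: sublinear_def)

lemma sublinear_vscale:
  assumes q: "sublinear q" and x: "x \<in> pts V" and r: "0 \<le> r"
  shows "q (vscale V (of_real r) x) = r * q x"
proof (rule antisym)
  show "q (vscale V (of_real r) x) \<le> r * q x" using assms by (simp add: sublinear_def)
  show "r * q x \<le> q (vscale V (of_real r) x)"
  proof (cases "r = 0")
    case True
    let ?z = "vscale V (0::'k) x"
    have "q ?z \<le> q ?z + q ?z"
      using sublinear_vadd[OF q, of ?z ?z] x by (simp add: vadd_zero vscale_closed)
    then show ?thesis using True by simp
  next
    case False
    have "q (vscale V (of_real (1 / r)) (vscale V (of_real r) x))
        \<le> 1 / r * q (vscale V (of_real r) x)"
      using q r vscale_closed[OF x, of "of_real r"] unfolding sublinear_def
      by (meson divide_nonneg_nonneg zero_le_one)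
    moreover have "vscale V (of_real (1 / r)) (vscale V (of_real r) x) = x"
      using x False by (simp add: vscale_vscale vscale_one flip: of_real_mult)
    ultimately show ?thesis using r False by (simp add: field_simps)
  qed
qed

lemma sublinear_zero: "sublinear q \<Longrightarrow> x \<in> pts V \<Longrightarrow> q (vscale V 0 x) = 0"
  using sublinear_vscale[of q x 0] by simp

lemma sublinear_minus:
  assumes "sublinear q" "x \<in> pts V"
  shows "- q (vscale V (-1) x) \<le> q x"
  using sublinear_vadd[of q "vscale V (-1) x" x] assms
  by (simp add: vadd_minus sublinear_zero vscale_closed)

text \<open>
  The largest sublinear functional below \<open>q\<close> with the value \<open>- q z\<close> at \<open>- z\<close>. It serves
  twice: applied to \<open>z = x\<close> it forces the value at the point \<open>x\<close> where the norm is to be attained,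
  and since it leaves a minimal sublinear functional fixed for every \<open>z\<close>, minimal ones are linear.
\<close>

definition tilt :: "'v \<Rightarrow> ('v \<Rightarrow> real) \<Rightarrow> 'v \<Rightarrow> real" where
  "tilt z q y = (INF t\<in>{0..}. q (vadd V y (vscale V (of_real t) z)) - t * q z)"

lemma INF_add_ge:
  fixes f g :: "'b \<Rightarrow> real"
  assumes "A \<noteq> {}" "\<And>a b. a \<in> A \<Longrightarrow> b \<in> A \<Longrightarrow> L \<le> f a + g b"
  shows "L \<le> (INF a\<in>A. f a) + (INF a\<in>A. g a)"
proof -
  have "L - f a \<le> (INF a\<in>A. g a)" if "a \<in> A" for a
    using assms that by (intro cINF_greatest) (auto simp: algebra_simps)
  then have "L - (INF a\<in>A. g a) \<le> (INF a\<in>A. f a)"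
    using assms(1) by (intro cINF_greatest) (auto simp: algebra_simps)
  then show ?thesis by simp
qed

lemma INF_mult_ge:
  fixes f :: "'b \<Rightarrow> real"
  assumes "A \<noteq> {}" "0 \<le> r" "\<And>a. a \<in> A \<Longrightarrow> L \<le> r * f a"
  shows "L \<le> r * (INF a\<in>A. f a)"
proof (cases "r = 0")
  case True
  then show ?thesis using assms by auto
next
  case False
  then have "L / r \<le> (INF a\<in>A. f a)"
    using assms by (intro cINF_greatest) (auto simp: field_simps)
  then show ?thesis using False assms(2) by (simp add: field_simps)
qed

lemma
  assumes q: "sublinear q" and z: "z \<in> pts V"
  shows sublinear_tilt: "sublinear (tilt z q)"
    and tilt_le: "y \<in> pts V \<Longrightarrow> tilt z q y \<le> q y"
    and tilt_minus: "tilt z q (vscale V (-1) z) \<le> - q z"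
proof -
  have mem: "vadd V y (vscale V c z) \<in> pts V" if "y \<in> pts V" for y c
    using that z by (simp add: vadd_closed vscale_closed)
  have lower: "- q (vscale V (-1) y) \<le> q (vadd V y (vscale V (of_real t) z)) - t * q z"
    if y: "y \<in> pts V" and t: "0 \<le> t" for y t
  proof -
    have "t * q z = q (vscale V (of_real t) z)" using sublinear_vscale[OF q z t] by simp
    also have "vscale V (of_real t) z
        = vadd V (vadd V y (vscale V (of_real t) z)) (vscale V (-1) y)"
      using vadd_minus_cancel[of "vscale V (of_real t) z" y] y z
      by (simp add: vscale_closed vadd_commute[of y])
    also have "q \<dots> \<le> q (vadd V y (vscale V (of_real t) z)) + q (vscale V (-1) y)"
      using y z by (intro sublinear_vadd[OF q]) (auto simp: vadd_closed vscale_closed)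
    finally show ?thesis by simp
  qed
  have upper: "tilt z q y \<le> q (vadd V y (vscale V (of_real t) z)) - t * q z"
    if y: "y \<in> pts V" and t: "0 \<le> t" for y t
    unfolding tilt_def
    by (rule cINF_lower) (use y t lower in \<open>auto intro!: bdd_belowI[of _ "- q (vscale V (-1) y)"]\<close>)
  show "tilt z q y \<le> q y" if y: "y \<in> pts V"
    using upper[OF y, of 0] y z by (simp add: vadd_zero)
  show "tilt z q (vscale V (-1) z) \<le> - q z"
    using upper[of "vscale V (-1) z" 1] z
    by (simp add: vscale_closed vscale_one vadd_minus sublinear_zero[OF q])
  show "sublinear (tilt z q)"
    unfolding sublinear_def
  proof (intro conjI ballI allI impI)
    fix x y assume x: "x \<in> pts V" and y: "y \<in> pts V"
    show "tilt z q (vadd V x y) \<le> tilt z q x + tilt z q y"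
      unfolding tilt_def[of z q x] tilt_def[of z q y]
    proof (rule INF_add_ge)
      fix t s :: real assume "t \<in> {0..}" "s \<in> {0..}"
      let ?a = "vadd V x (vscale V (of_real t) z)" and ?b = "vadd V y (vscale V (of_real s) z)"
      let ?tz = "vscale V (of_real t) z" and ?sz = "vscale V (of_real s) z"
      have z': "?tz \<in> pts V" "?sz \<in> pts V" using z by (auto simp: vscale_closed)
      have "vadd V (vadd V x y) (vscale V (of_real (t + s)) z)
          = vadd V x (vadd V y (vadd V ?tz ?sz))"
        using x y z z' by (simp add: vscale_add vadd_assoc vadd_closed)
      also have "vadd V y (vadd V ?tz ?sz) = vadd V ?tz ?b"
        using y z' vadd_assoc[of y ?tz ?sz] vadd_assoc[of ?tz y ?sz] vadd_commute[of y ?tz] by simp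
      also have "vadd V x (vadd V ?tz ?b) = vadd V ?a ?b"
        using x y z' by (simp add: vadd_assoc vadd_closed)
      finally have "tilt z q (vadd V x y) \<le> q (vadd V ?a ?b) - (t + s) * q z"
        using upper[OF vadd_closed[OF x y], of "t + s"] \<open>t \<in> _\<close> \<open>s \<in> _\<close> by simp
      also have "q (vadd V ?a ?b) \<le> q ?a + q ?b"
        using mem x y by (intro sublinear_vadd[OF q])
      finally show "tilt z q (vadd V x y) \<le> q ?a - t * q z + (q ?b - s * q z)"
        by (simp add: algebra_simps)
    qed simp
  next
    fix x and r :: real assume x: "x \<in> pts V" and r: "0 \<le> r"
    show "tilt z q (vscale V (of_real r) x) \<le> r * tilt z q x"
      unfolding tilt_def[of z q x]
    proof (rule INF_mult_ge)
      fix t :: real assume t: "t \<in> {0..}"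
      let ?a = "vadd V x (vscale V (of_real t) z)"
      have "vadd V (vscale V (of_real r) x) (vscale V (of_real (r * t)) z)
          = vscale V (of_real r) ?a"
        using x z by (simp add: vscale_vadd vscale_vscale vscale_closed)
      then have "tilt z q (vscale V (of_real r) x) \<le> q (vscale V (of_real r) ?a) - r * t * q z"
        using upper[OF vscale_closed[OF x], of "r * t" "of_real r"] r t by simp
      also have "q (vscale V (of_real r) ?a) = r * q ?a"
        using mem x r by (intro sublinear_vscale[OF q])
      finally show "tilt z q (vscale V (of_real r) x) \<le> r * (q ?a - t * q z)"
        by (simp add: algebra_simps)
    qed (use r in auto)
  qed
qed

text \<open>Zorn's lemma applies because the pointwise infimum of a chain is again sublinear.\<close>

lemma minimal_sublinear_exists:
  assumes p: "sublinear p"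
  shows "\<exists>q. sublinear q \<and> (\<forall>y\<in>pts V. q y \<le> p y) \<and>
    (\<forall>r. sublinear r \<longrightarrow> (\<forall>y\<in>pts V. r y \<le> q y) \<longrightarrow> (\<forall>y\<in>pts V. r y = q y))"
proof -
  have sublinear_cong: "sublinear (restrict q (pts V)) \<longleftrightarrow> sublinear q" for q
    by (simp add: sublinear_def vadd_closed vscale_closed)
  \<comment> \<open>Fixing the values off the carrier makes the pointwise order antisymmetric.\<close>
  define A where "A = {q \<in> extensional (pts V). sublinear q \<and> (\<forall>y\<in>pts V. q y \<le> p y)}"
  define P where "P = (\<lambda>q r :: 'v \<Rightarrow> real. \<forall>y\<in>pts V. r y \<le> q y)"
  have "partial_order_on A (relation_of P A)"
  proof (rule partial_order_on_relation_ofI)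
    fix q r assume "q \<in> A" "r \<in> A" "P q r" "P r q"
    then show "q = r"
      by (intro extensionalityI[of _ "pts V"]) (auto simp: A_def P_def intro: antisym)
  qed (auto simp: P_def intro: order_trans)
  moreover have "\<exists>u\<in>A. \<forall>q\<in>C. P q u" if C: "C \<in> Chains (relation_of P A)" for C
  proof (cases "C = {}")
    case True
    have "restrict p (pts V) \<in> A" using p by (simp add: A_def sublinear_cong)
    then show ?thesis using True by auto
  next
    case False
    define u where "u y = (INF q\<in>C. q y)" for y
    have CA: "q \<in> A" if "q \<in> C" for q
      using C that by (auto simp: Chains_def relation_of_def)
    have chain: "P q r \<or> P r q" if "q \<in> C" "r \<in> C" for q r
      using C that by (auto simp: Chains_def relation_of_def)
    have sub: "sublinear q" and below: "y \<in> pts V \<Longrightarrow> q y \<le> p y" if "q \<in> C" for q y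
      using CA[OF that] by (auto simp: A_def)
    have u_le: "u y \<le> q y" if "q \<in> C" "y \<in> pts V" for q y
      unfolding u_def
    proof (rule cINF_lower)
      have "- p (vscale V (-1) y) \<le> r y" if "r \<in> C" for r
        using sublinear_minus[OF sub[OF that] \<open>y \<in> pts V\<close>]
          below[OF that, of "vscale V (-1) y"] \<open>y \<in> pts V\<close>
        by (simp add: vscale_closed)
      then show "bdd_below ((\<lambda>q. q y) ` C)"
        by (intro bdd_belowI[of _ "- p (vscale V (-1) y)"]) auto
    qed (use that in auto)
    have "sublinear u"
      unfolding sublinear_def
    proof (intro conjI ballI allI impI)
      fix x y assume x: "x \<in> pts V" and y: "y \<in> pts V"
      show "u (vadd V x y) \<le> u x + u y"
        unfolding u_def[of x] u_def[of y]
      proof (rule INF_add_ge[OF False])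
        fix q r assume q: "q \<in> C" and r: "r \<in> C"
        obtain s where s: "s \<in> C" "s x \<le> q x" "s y \<le> r y"
          using chain[OF q r] q r x y unfolding P_def by fastforce
        have "u (vadd V x y) \<le> s (vadd V x y)" using u_le s x y by (simp add: vadd_closed)
        also have "\<dots> \<le> s x + s y" using sub[OF s(1)] x y by (rule sublinear_vadd)
        finally show "u (vadd V x y) \<le> q x + r y" using s by simp
      qed
    next
      fix x and r :: real assume x: "x \<in> pts V" and r: "0 \<le> r"
      show "u (vscale V (of_real r) x) \<le> r * u x"
        unfolding u_def[of x]
      proof (rule INF_mult_ge[OF False r])
        fix q assume q: "q \<in> C"
        show "u (vscale V (of_real r) x) \<le> r * q x"
          using u_le[OF q vscale_closed[OF x]] sublinear_vscale[OF sub[OF q] x r] by metis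
      qed
    qed
    moreover obtain q0 where "q0 \<in> C" using False by auto
    then have "u y \<le> p y" if "y \<in> pts V" for y
      using u_le[of q0 y] below[of q0 y] that by simp
    ultimately have "restrict u (pts V) \<in> A" by (simp add: A_def sublinear_cong)
    moreover have "\<forall>q\<in>C. P q (restrict u (pts V))" using u_le by (simp add: P_def)
    ultimately show ?thesis by blast
  qed
  ultimately obtain q where q: "q \<in> A" "\<And>r. r \<in> A \<Longrightarrow> P q r \<Longrightarrow> r = q"
    using predicate_Zorn[of A P] by blast
  show ?thesis
  proof (intro exI[of _ q] conjI allI impI ballI)
    show "sublinear q" "\<And>y. y \<in> pts V \<Longrightarrow> q y \<le> p y" using q(1) by (auto simp: A_def)
    fix r y assume r: "sublinear r" "\<forall>y\<in>pts V. r y \<le> q y" and y: "y \<in> pts V"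
    have "r y \<le> p y" if "y \<in> pts V" for y
      using r(2) q(1) that by (force simp: A_def)
    then have "restrict r (pts V) \<in> A" using r by (simp add: A_def sublinear_cong)
    moreover have "P q (restrict r (pts V))" using r by (simp add: P_def)
    ultimately have "restrict r (pts V) = q" by (rule q(2))
    then show "r y = q y" using y by (metis restrict_apply')
  qed
qed

text \<open>
  A minimal sublinear functional \<open>f\<close> below \<open>tilt x p\<close> is fixed by \<open>tilt z\<close>, so \<open>f (- z) \<le> - f z\<close> for all
  \<open>z\<close>: subadditivity and positive homogeneity turn into linearity. At \<open>- x\<close> the starting functional
  is at most \<open>- p x\<close>, hence \<open>f x \<ge> p x\<close>.
\<close>

theorem hahn_banach_sublinear:
  assumes p: "sublinear p" and x: "x \<in> pts V"
  obtains f where "\<And>y z. y \<in> pts V \<Longrightarrow> z \<in> pts V \<Longrightarrow> f (vadd V y z) = f y + f z"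
    "\<And>r y. y \<in> pts V \<Longrightarrow> f (vscale V (of_real r) y) = r * f y"
    "\<And>y. y \<in> pts V \<Longrightarrow> f y \<le> p y" "f x = p x"
proof -
  obtain f where f: "sublinear f" "\<forall>y\<in>pts V. f y \<le> tilt x p y"
    and min: "\<And>r. sublinear r \<Longrightarrow> \<forall>y\<in>pts V. r y \<le> f y \<Longrightarrow> \<forall>y\<in>pts V. r y = f y"
    using minimal_sublinear_exists[OF sublinear_tilt[OF p x]] by blast
  have minus: "f (vscale V (-1) z) = - f z" if z: "z \<in> pts V" for z
  proof -
    have "tilt z f (vscale V (-1) z) = f (vscale V (-1) z)"
      using min[OF sublinear_tilt[OF f(1) z]] tilt_le[OF f(1) z] vscale_closed[OF z] by blast
    then show ?thesis
      using tilt_minus[OF f(1) z] sublinear_minus[OF f(1) z] by simp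
  qed
  show ?thesis
  proof (rule that[of f])
    fix y z assume y: "y \<in> pts V" and z: "z \<in> pts V"
    have "f y \<le> f (vadd V y z) + f (vscale V (-1) z)"
      using sublinear_vadd[OF f(1), of "vadd V y z" "vscale V (-1) z"] y z
      by (simp add: vadd_minus_cancel vadd_closed vscale_closed)
    then show "f (vadd V y z) = f y + f z"
      using minus[OF z] sublinear_vadd[OF f(1) y z] by simp
  next
    fix r :: real and y assume y: "y \<in> pts V"
    show "f (vscale V (of_real r) y) = r * f y"
    proof (cases "0 \<le> r")
      case True
      then show ?thesis using sublinear_vscale[OF f(1) y] by simp
    next
      case False
      have "vscale V (of_real r) y = vscale V (-1) (vscale V (of_real (- r)) y)"
        using y by (simp add: vscale_vscale)
      also have "f \<dots> = - f (vscale V (of_real (- r)) y)" by (rule minus[OF vscale_closed[OF y]])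
      also have "\<dots> = r * f y" using sublinear_vscale[OF f(1) y, of "- r"] False by simp
      finally show ?thesis .
    qed
  next
    show le: "f y \<le> p y" if "y \<in> pts V" for y
      using f(2) tilt_le[OF p x that] that by force
    have "- f x \<le> - p x"
      using minus[OF x] f(2) vscale_closed[OF x, of "-1"] tilt_minus[OF p x] by force
    then show "f x = p x" using le[OF x] by simp
  qed
qed

lemma sublinear_vnorm: "sublinear (vnorm V)"
  by (simp add: sublinear_def vnorm_triangle vnorm_vscale)

end

lemma state_exists_real:
  fixes V :: "(real, 'v) normed_structure"
  assumes V: "seminormed_space V" and x: "x \<in> pts V" "vnorm V x = 1"
  shows "\<exists>\<phi>. (x, \<phi>) \<in> state_pairs V"
proof -
  interpret seminormed_space V by (rule V)
  obtain f where f: "\<And>y z. y \<in> pts V \<Longrightarrow> z \<in> pts V \<Longrightarrow> f (vadd V y z) = f y + f z"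
    "\<And>r y. y \<in> pts V \<Longrightarrow> f (vscale V (of_real r) y) = r * f y"
    "\<And>y. y \<in> pts V \<Longrightarrow> f y \<le> vnorm V y" "f x = vnorm V x"
    using hahn_banach_sublinear[OF sublinear_vnorm x(1)] by blast
  have "norm (f y) \<le> vnorm V y" if y: "y \<in> pts V" for y
    using f(3)[OF y] f(3)[OF vscale_closed[OF y], of "-1"] f(2)[OF y, of "-1"] y
    by (simp add: vnorm_vscale)
  then have "(x, f) \<in> state_pairs V"
    using x f by (intro state_pairsI) (auto simp: of_real_def)
  then show ?thesis by blast
qed

text \<open>
  A real functional \<open>f\<close> is the real part of exactly one complex-linear functional, namely
  \<open>\<phi> y = f y - i f (i y)\<close>. Rotating \<open>y\<close> until \<open>\<phi> y\<close> is real shows that the norm does not grow.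
\<close>

lemma state_exists_complex:
  fixes V :: "(complex, 'v) normed_structure"
  assumes V: "seminormed_space V" and x: "x \<in> pts V" "vnorm V x = 1"
  shows "\<exists>\<phi>. (x, \<phi>) \<in> state_pairs V"
proof -
  interpret seminormed_space V by (rule V)
  obtain f where f: "\<And>y z. y \<in> pts V \<Longrightarrow> z \<in> pts V \<Longrightarrow> f (vadd V y z) = f y + f z"
    "\<And>r y. y \<in> pts V \<Longrightarrow> f (vscale V (of_real r) y) = r * f y"
    "\<And>y. y \<in> pts V \<Longrightarrow> f y \<le> vnorm V y" "f x = vnorm V x"
    using hahn_banach_sublinear[OF sublinear_vnorm x(1)] by blast
  define \<phi> where "\<phi> = (\<lambda>y. Complex (f y) (- f (vscale V \<i> y)))"
  have f_scale: "f (vscale V c y) = Re c * f y + Im c * f (vscale V \<i> y)"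
    if y: "y \<in> pts V" for c y
  proof -
    have "vscale V c y = vscale V (of_real (Re c) + of_real (Im c) * \<i>) y"
      by (rule arg_cong[where f = "\<lambda>c. vscale V c y"]) (simp add: complex_eq_iff)
    also have "\<dots> = vadd V (vscale V (of_real (Re c)) y)
        (vscale V (of_real (Im c)) (vscale V \<i> y))"
      using y by (simp only: vscale_add vscale_vscale)
    finally show ?thesis using y by (simp add: f vscale_closed)
  qed
  have add: "\<phi> (vadd V y z) = \<phi> y + \<phi> z" if "y \<in> pts V" "z \<in> pts V" for y z
    using that by (simp add: \<phi>_def f vscale_vadd vscale_closed complex_eq_iff)
  have scale: "\<phi> (vscale V c y) = c * \<phi> y" if y: "y \<in> pts V" for c y
    using y f_scale[OF y, of c] f_scale[OF y, of "\<i> * c"]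
    by (simp add: \<phi>_def vscale_vscale complex_eq_iff)
  have bound: "norm (\<phi> y) \<le> vnorm V y" if y: "y \<in> pts V" for y
  proof (cases "\<phi> y = 0")
    case True
    then show ?thesis using vnorm_nonneg[OF y] by simp
  next
    case False
    define \<theta> where "\<theta> = of_real (cmod (\<phi> y)) / \<phi> y"
    have \<theta>: "cmod \<theta> = 1" "\<theta> * \<phi> y = of_real (cmod (\<phi> y))"
      using False by (auto simp: \<theta>_def norm_divide)
    have "cmod (\<phi> y) = Re (\<phi> (vscale V \<theta> y))" using scale[OF y] \<theta>(2) by simp
    also have "\<dots> = f (vscale V \<theta> y)" by (simp add: \<phi>_def)
    also have "\<dots> \<le> vnorm V y"
      using f(3)[OF vscale_closed[OF y], of \<theta>] y \<theta>(1) by (simp add: vnorm_vscale)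
    finally show ?thesis .
  qed
  have "\<phi> x = 1"
  proof -
    have Re: "Re (\<phi> x) = 1" using f(4) x by (simp add: \<phi>_def)
    have "(Re (\<phi> x))\<^sup>2 + (Im (\<phi> x))\<^sup>2 \<le> 1"
      using bound[OF x(1)] x(2) by (simp add: cmod_def)
    then show ?thesis using Re by (simp add: complex_eq_iff)
  qed
  then have "(x, \<phi>) \<in> state_pairs V"
    using x add scale bound by (intro state_pairsI) auto
  then show ?thesis by blast
qed


section \<open>Lumer's growth estimate\<close>

locale normed_scaling = vector_space sc
  for sc :: "'k::real_normed_field \<Rightarrow> 'a::real_normed_vector \<Rightarrow> 'a" +
  assumes norm_sc: "norm (sc c x) = norm c * norm x"
begin

lemma seminormed_space_type_space: "seminormed_space (type_space sc)"
  by unfold_locales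
    (auto simp: type_space_def scale_right_distrib scale_left_distrib norm_sc
      norm_triangle_ineq algebra_simps)

lemma bounded_operatorD:
  assumes "T \<in> bounded_operators (type_space sc)"
  shows "T (x + y) = T x + T y" "T (x - y) = T x - T y" "T (sc c x) = sc c (T x)" "T 0 = 0"
    "norm (T x) \<le> operator_norm (type_space sc) T * norm x"
proof -
  show add: "T (x + y) = T x + T y" for x y
    using assms by (simp add: bounded_operators_def type_space_def)
  show "T (x - y) = T x - T y" using add[of "x - y" y] by simp
  show "T 0 = 0" using add[of 0 0] by simp
  show "T (sc c x) = sc c (T x)"
    using assms by (simp add: bounded_operators_def type_space_def)
  show "norm (T x) \<le> operator_norm (type_space sc) T * norm x"
    using seminormed_space.vnorm_le_operator_norm[OF seminormed_space_type_space assms, of x]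
    by (simp add: type_space_def)
qed

text \<open>For a state \<open>(u, \<phi>)\<close>, the norm of \<open>u + c T u\<close> is at least \<open>\<bar>\<phi> (u + c T u)\<bar> = \<bar>1 + c \<phi> (T u)\<bar>\<close>.\<close>

lemma norm_perturbed_identity_ge:
  assumes T: "T \<in> bounded_operators (type_space sc)"
    and states: "\<And>x. norm x = 1 \<Longrightarrow> \<exists>\<phi>. (x, \<phi>) \<in> state_pairs (type_space sc)"
  shows "(1 - norm c * numerical_radius (type_space sc) T) * norm x \<le> norm (x + sc c (T x))"
proof (cases "x = 0")
  case True
  then show ?thesis by simp
next
  case False
  interpret X: seminormed_space "type_space sc" by (rule seminormed_space_type_space)
  let ?w = "numerical_radius (type_space sc) T"
  define r where "r = (of_real (inverse (norm x)) :: 'k)"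
  define u where "u = sc r x"
  have r: "norm r = inverse (norm x)" by (simp add: r_def norm_inverse)
  have u: "norm u = 1" using False by (simp add: u_def norm_sc r)
  then obtain \<phi> where \<phi>: "(u, \<phi>) \<in> state_pairs (type_space sc)" using states by blast
  have "\<phi> (u + sc c (T u)) = 1 + c * \<phi> (T u)"
    using \<phi> by (simp add: state_pairs_def dual_space_def type_space_def)
  moreover have "norm (\<phi> (u + sc c (T u))) \<le> norm (u + sc c (T u))"
    using X.state_le_vnorm[OF \<phi>, of "u + sc c (T u)"] by (simp add: type_space_def)
  moreover have "norm c * norm (\<phi> (T u)) \<le> norm c * ?w"
    by (intro mult_left_mono X.norm_state_le_numerical_radius[OF T \<phi>]) simp
  moreover have "1 - norm (c * \<phi> (T u)) \<le> norm (1 + c * \<phi> (T u))"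
    using norm_diff_ineq[of "1::'k" "c * \<phi> (T u)"] by simp
  ultimately have "1 - norm c * ?w \<le> norm (u + sc c (T u))" by (simp add: norm_mult)
  also have "u + sc c (T u) = sc r (x + sc c (T x))"
    by (simp add: u_def bounded_operatorD[OF T] scale_right_distrib mult.commute)
  also have "norm \<dots> = norm (x + sc c (T x)) / norm x"
    by (simp add: norm_sc r divide_inverse mult.commute)
  finally show ?thesis using False by (simp add: field_simps)
qed

text \<open>
  The lower bound at \<open>-c\<close>, applied to \<open>y + c T y\<close>, becomes an upper bound, because
  \<open>(I - c T) (I + c T) = I - c\<^sup>2 T\<^sup>2\<close> differs from the identity only to second order.
\<close>

lemma norm_perturbed_identity_le:
  assumes T: "T \<in> bounded_operators (type_space sc)"
    and states: "\<And>x. norm x = 1 \<Longrightarrow> \<exists>\<phi>. (x, \<phi>) \<in> state_pairs (type_space sc)"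
  shows "(1 - norm c * numerical_radius (type_space sc) T) * norm (y + sc c (T y))
    \<le> (1 + (norm c * operator_norm (type_space sc) T)\<^sup>2) * norm y"
proof -
  let ?K = "operator_norm (type_space sc) T"
  have "(1 - norm c * numerical_radius (type_space sc) T) * norm (y + sc c (T y))
      \<le> norm (y + sc c (T y) + sc (- c) (T (y + sc c (T y))))"
    using norm_perturbed_identity_ge[OF T states, of "- c" "y + sc c (T y)"] by simp
  also have "y + sc c (T y) + sc (- c) (T (y + sc c (T y))) = y - sc (c * c) (T (T y))"
    by (simp add: bounded_operatorD[OF T] scale_right_distrib)
  also have "norm \<dots> \<le> norm y + (norm c)\<^sup>2 * norm (T (T y))"
    using norm_triangle_ineq4[of y "sc (c * c) (T (T y))"]
    by (simp add: norm_sc norm_mult power2_eq_square)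
  also have "(norm c)\<^sup>2 * norm (T (T y)) \<le> (norm c)\<^sup>2 * (?K\<^sup>2 * norm y)"
  proof (rule mult_left_mono)
    show "norm (T (T y)) \<le> ?K\<^sup>2 * norm y"
    proof (cases "0 \<le> ?K")
      case True
      have "norm (T (T y)) \<le> ?K * norm (T y)" by (rule bounded_operatorD[OF T])
      also have "\<dots> \<le> ?K * (?K * norm y)"
        using True by (intro mult_left_mono bounded_operatorD[OF T])
      finally show ?thesis by (simp add: power2_eq_square)
    next
      case False
      have "norm (T x) \<le> 0" for x
      proof -
        have "?K * norm x \<le> 0" using False by (intro mult_nonpos_nonneg) auto
        then show ?thesis using bounded_operatorD(5)[OF T, of x] by linarith
      qed
      then show ?thesis by simp
    qed
  qed simp
  finally show ?thesis by (simp add: algebra_simps power_mult_distrib)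
qed

end


section \<open>The space \<open>E(X)\<close> and pointwise operators\<close>

locale koethe_bochner = koethe_function_space M E N + normed_scaling sc
  for M :: "'w measure" and E N
    and sc :: "'k::real_normed_field \<Rightarrow> 'a::real_normed_vector \<Rightarrow> 'a" +
  assumes complete_measure: "complete_measure M"
    and finite_positive_set: "\<exists>A\<in>sets M. 0 < emeasure M A \<and> emeasure M A < \<infinity>"
begin

abbreviation F :: "('w \<Rightarrow> 'a) set" where
  "F \<equiv> koethe_bochner_fns M E"

abbreviation E_X :: "('k, ('w \<Rightarrow> 'a) set) normed_structure" where
  "E_X \<equiv> koethe_bochner_space M E N sc"

lemma pts_E_X: "pts E_X = cls ` F"
  by (auto simp: koethe_bochner_space_def Let_def quotient_def)

lemma scale_facts: "norm (sc c x) = norm c * norm x" "sc c (x - y) = sc c x - sc c y"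
  by (simp_all add: norm_sc scale_right_diff_distrib)

lemmas E_X_simps = vadd_cls[OF complete_measure] vscale_cls[OF scale_facts] vnorm_cls
  koethe_bochner_fns_add[OF complete_measure] koethe_bochner_fns_scale[OF scale_facts]

text \<open>
  Solidity of \<open>E\<close> speaks of members of \<open>L0\<close>; for norms of strongly measurable functions, local
  integrability comes with the bound.
\<close>

lemma strongly_measurable_dominated:
  fixes f :: "'w \<Rightarrow> 'a"
  assumes f: "strongly_measurable M f" and g: "g \<in> E" and fg: "\<And>t. norm (f t) \<le> \<bar>g t\<bar>"
  shows "f \<in> F" and "N (\<lambda>t. norm (f t)) \<le> N g"
proof -
  have meas: "(\<lambda>t. norm (f t)) \<in> borel_measurable M"
    using complete_measure f by (rule strongly_measurable_norm)
  have "set_integrable M A (\<lambda>t. norm (f t))"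
    if A: "A \<in> sets M" "emeasure M A < \<infinity>" for A
  proof -
    have int: "integrable M (\<lambda>t. indicator A t *\<^sub>R g t)"
      using g subset_L0 A by (auto simp: L0_def set_integrable_def)
    show ?thesis
      unfolding set_integrable_def
    proof (rule Bochner_Integration.integrable_bound[OF int])
      show "(\<lambda>t. indicator A t *\<^sub>R norm (f t)) \<in> borel_measurable M"
        using meas A(1) by measurable
    qed (auto simp: indicator_def fg)
  qed
  with meas have "(\<lambda>t. norm (f t)) \<in> L0 M" by (simp add: L0_def)
  moreover have "AE t in M. \<bar>norm (f t)\<bar> \<le> \<bar>g t\<bar>" using fg by simp
  ultimately have "(\<lambda>t. norm (f t)) \<in> E \<and> N (\<lambda>t. norm (f t)) \<le> N g"
    using solid[of "\<lambda>t. norm (f t)" g] g by blast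
  then show "f \<in> F" and "N (\<lambda>t. norm (f t)) \<le> N g"
    using f by (auto simp: koethe_bochner_fns_def)
qed

lemma zero_fns: "(\<lambda>t. 0) \<in> F"
  using zero_mem
  by (auto simp: koethe_bochner_fns_def strongly_measurable_def intro!: exI[of _ "\<lambda>n t. 0"])

lemma N_norm_mono_scaled:
  assumes f: "f \<in> F" and g: "g \<in> F" and le: "\<And>t. norm (f t) \<le> b * norm (g t)" and b: "0 \<le> b"
  shows "N (\<lambda>t. norm (f t)) \<le> b * N (\<lambda>t. norm (g t))"
proof -
  have g': "(\<lambda>t. norm (g t)) \<in> E" using g by (simp add: koethe_bochner_fns_def)
  have "N (\<lambda>t. norm (f t)) \<le> N (\<lambda>t. b * norm (g t))"
  proof (rule strongly_measurable_dominated)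
    show "strongly_measurable M f" using f by (simp add: koethe_bochner_fns_def)
    show "(\<lambda>t. b * norm (g t)) \<in> E" using g' by (rule scale_mem)
    show "norm (f t) \<le> \<bar>b * norm (g t)\<bar>" for t using le[of t] b by (simp add: abs_mult)
  qed
  then show ?thesis using norm_scale[OF g', of b] b by simp
qed

lemma seminormed_space_E_X: "seminormed_space E_X"
proof unfold_locales
  fix x y assume "x \<in> pts E_X" "y \<in> pts E_X"
  then obtain f g where fg: "f \<in> F" "x = cls f" "g \<in> F" "y = cls g" by (auto simp: pts_E_X)
  have "(\<lambda>t. norm (f t)) \<in> E" "(\<lambda>t. norm (g t)) \<in> E" "(\<lambda>t. norm (f t + g t)) \<in> E"
    using fg koethe_bochner_fns_add[OF complete_measure fg(1,3)]
    by (auto simp: koethe_bochner_fns_def)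
  note mem = this
  have "N (\<lambda>t. norm (f t + g t)) \<le> N (\<lambda>t. norm (f t) + norm (g t))"
    using koethe_bochner_fns_add[OF complete_measure fg(1,3)] add_mem[OF mem(1,2)]
    by (intro strongly_measurable_dominated)
      (auto simp: koethe_bochner_fns_def norm_triangle_ineq)
  also have "\<dots> \<le> N (\<lambda>t. norm (f t)) + N (\<lambda>t. norm (g t))"
    by (rule norm_triangle[OF mem(1,2)])
  finally show "vnorm E_X (vadd E_X x y) \<le> vnorm E_X x + vnorm E_X y"
    using fg by (simp add: E_X_simps)
next
  fix x c assume "x \<in> pts E_X"
  then obtain f where f: "f \<in> F" "x = cls f" by (auto simp: pts_E_X)
  then have "(\<lambda>t. norm (f t)) \<in> E" by (simp add: koethe_bochner_fns_def)
  from norm_scale[OF this, of "norm c"] show "vnorm E_X (vscale E_X c x) = norm c * vnorm E_X x"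
    using f by (simp add: E_X_simps norm_sc)
qed (auto simp: pts_E_X E_X_simps zero_fns ac_simps scale_right_distrib scale_left_distrib)

text \<open>
  Here \<open>e\<close> is the normalized indicator function of a set of finite positive measure. The copy of
  \<open>X\<close> is mapped into itself by pointwise operators, so these keep their norm on \<open>E(X)\<close>, and it
  provides unit vectors of \<open>E(X)\<close>.
\<close>

lemma isometric_copy:
  obtains e :: "'w \<Rightarrow> 'k"
  where "\<And>x. (\<lambda>t. sc (e t) x) \<in> F" "\<And>x. N (\<lambda>t. norm (sc (e t) x)) = norm x"
proof -
  obtain A where A: "A \<in> sets M" "0 < emeasure M A" "emeasure M A < \<infinity>"
    using finite_positive_set by blast
  let ?k = "N (indicator A)"
  have ind: "(indicator A :: 'w \<Rightarrow> real) \<in> E" using A by (rule indicator_mem)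
  have "?k \<noteq> 0"
  proof
    assume "?k = 0"
    then have "AE t in M. indicator A t = (0::real)" using norm_eq_zero[OF ind] by simp
    then have "AE t in M. t \<notin> A" by (simp add: indicator_eq_0_iff)
    then have "A \<in> null_sets M" using A(1) by (simp add: AE_iff_null_sets)
    then show False using A(2) by auto
  qed
  moreover have "0 \<le> ?k"
  proof -
    have "N (\<lambda>t. 0) = 0" using norm_eq_zero[OF zero_mem] by simp
    then show ?thesis
      using norm_triangle[OF ind scale_mem[OF ind, of "-1"]] norm_scale[OF ind, of "-1"] by simp
  qed
  ultimately have k: "0 < ?k" by simp
  define e where "e = (\<lambda>t. of_real (indicator A t / ?k) :: 'k)"
  have e_norm: "norm (sc (e t) x) = norm x / ?k * indicator A t" for t x
    using k by (simp add: e_def norm_sc indicator_def norm_divide)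
  show ?thesis
  proof (rule that[of e])
    fix x
    have "simple_function M (\<lambda>t. sc (e t) x)"
      unfolding e_def
      by (rule simple_function_compose1[OF simple_function_indicator[OF A(1)]])
    then have "strongly_measurable M (\<lambda>t. sc (e t) x)"
      unfolding strongly_measurable_def by (intro exI[of _ "\<lambda>n t. sc (e t) x"]) auto
    moreover have "(\<lambda>t. norm (sc (e t) x)) \<in> E"
      unfolding e_norm using ind by (rule scale_mem)
    ultimately show "(\<lambda>t. sc (e t) x) \<in> F" by (simp add: koethe_bochner_fns_def)
    show "N (\<lambda>t. norm (sc (e t) x)) = norm x"
      unfolding e_norm using norm_scale[OF ind, of "norm x / ?k"] k by simp
  qed
qed

definition lift_operator :: "('a \<Rightarrow> 'a) \<Rightarrow> ('w \<Rightarrow> 'a) set \<Rightarrow> ('w \<Rightarrow> 'a) set" where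
  "lift_operator T A = (\<Union>f\<in>A. cls (\<lambda>t. T (f t)))"

context
  fixes T assumes T: "T \<in> bounded_operators (type_space sc)"
begin

lemma operator_fns:
  assumes f: "f \<in> F"
  shows "(\<lambda>t. T (f t)) \<in> F"
proof (rule strongly_measurable_dominated)
  let ?K = "operator_norm (type_space sc) T"
  obtain s where s: "\<And>n. simple_function M (s n)" "AE t in M. (\<lambda>n. s n t) \<longlonglongrightarrow> f t"
    using f unfolding koethe_bochner_fns_def strongly_measurable_def by auto
  have "AE t in M. (\<lambda>n. T (s n t)) \<longlonglongrightarrow> T (f t)"
    using s(2)
  proof eventually_elim
    case (elim t)
    have "(\<lambda>n. T (s n t - f t)) \<longlonglongrightarrow> 0"
    proof (rule Lim_null_comparison)
      show "\<forall>\<^sub>F n in sequentially. norm (T (s n t - f t)) \<le> ?K * norm (s n t - f t)"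
        by (intro always_eventually allI bounded_operatorD[OF T])
      show "(\<lambda>n. ?K * norm (s n t - f t)) \<longlonglongrightarrow> 0"
        using elim by (intro tendsto_mult_right_zero) (simp add: LIM_zero_iff tendsto_norm_zero)
    qed
    then show ?case by (simp add: bounded_operatorD[OF T] LIM_zero_iff)
  qed
  moreover have "simple_function M (\<lambda>t. T (s n t))" for n
    using s(1) by (rule simple_function_compose1)
  ultimately show "strongly_measurable M (\<lambda>t. T (f t))"
    unfolding strongly_measurable_def by (intro exI[of _ "\<lambda>n t. T (s n t)"]) auto
  show "(\<lambda>t. ?K * norm (f t)) \<in> E" using f by (simp add: koethe_bochner_fns_def scale_mem)
  show "norm (T (f t)) \<le> \<bar>?K * norm (f t)\<bar>" for t
    using bounded_operatorD(5)[OF T, of "f t"] by linarith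
qed

lemma lift_operator_cls:
  assumes f: "f \<in> F"
  shows "lift_operator T (cls f) = cls (\<lambda>t. T (f t))"
proof -
  have "cls (\<lambda>t. T (g t)) = cls (\<lambda>t. T (f t))" if g: "g \<in> cls f" for g
  proof (rule equiv_class_eq[OF equiv_ae_rel])
    have "g \<in> F" "AE t in M. f t = g t" using g by (auto simp: ae_rel_def)
    moreover from this(2) have "AE t in M. T (g t) = T (f t)" by eventually_elim simp
    ultimately show "((\<lambda>t. T (g t)), (\<lambda>t. T (f t))) \<in> ae_rel M F"
      using operator_fns f by (auto simp: ae_rel_def)
  qed
  moreover have "cls f \<noteq> {}" using equiv_class_self[OF equiv_ae_rel] f by blast
  ultimately show ?thesis by (auto simp: lift_operator_def)
qed

lemma vnorm_lift_operator_le: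
  assumes K: "0 \<le> operator_norm (type_space sc) T" and x: "x \<in> pts E_X"
  shows "vnorm E_X (lift_operator T x) \<le> operator_norm (type_space sc) T * vnorm E_X x"
proof -
  obtain f where f: "f \<in> F" "x = cls f" using x by (auto simp: pts_E_X)
  then show ?thesis
    using N_norm_mono_scaled[OF operator_fns[OF f(1)] f(1) bounded_operatorD(5)[OF T] K]
    by (simp add: lift_operator_cls vnorm_cls operator_fns)
qed

lemma lift_operator_bounded:
  assumes K: "0 \<le> operator_norm (type_space sc) T"
  shows "lift_operator T \<in> bounded_operators E_X"
proof -
  have "\<exists>C. \<forall>x\<in>pts E_X. vnorm E_X (lift_operator T x) \<le> C * vnorm E_X x"
    using vnorm_lift_operator_le[OF K] by blast
  then show ?thesis
    unfolding bounded_operators_def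
    by (auto simp: pts_E_X lift_operator_cls E_X_simps operator_fns bounded_operatorD[OF T])
qed

lemma operator_norm_lift_operator:
  assumes K: "0 \<le> operator_norm (type_space sc) T"
  shows "operator_norm E_X (lift_operator T) = operator_norm (type_space sc) T"
proof -
  interpret seminormed_space E_X by (rule seminormed_space_E_X)
  obtain e where e: "\<And>x. (\<lambda>t. sc (e t) x) \<in> F" "\<And>x. N (\<lambda>t. norm (sc (e t) x)) = norm x"
    using isometric_copy by metis
  have le: "vnorm E_X (lift_operator T x) \<le> operator_norm (type_space sc) T"
    if "x \<in> pts E_X" "vnorm E_X x \<le> 1" for x
    using vnorm_lift_operator_le[OF K that(1)] mult_left_mono[OF that(2) K] by simp
  show ?thesis
  proof (rule antisym)
    have "cls (\<lambda>t. sc (e t) 0) \<in> {x \<in> pts E_X. vnorm E_X x \<le> 1}"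
      using e(1)[of 0] e(2)[of 0] by (simp add: pts_E_X vnorm_cls)
    then show "operator_norm E_X (lift_operator T) \<le> operator_norm (type_space sc) T"
      unfolding operator_norm_def[of E_X] using le by (intro cSUP_least) auto
    show "operator_norm (type_space sc) T \<le> operator_norm E_X (lift_operator T)"
      unfolding operator_norm_def[of "type_space sc"]
    proof (rule cSUP_least)
      show "{x \<in> pts (type_space sc). vnorm (type_space sc) x \<le> 1} \<noteq> {}"
        by (auto simp: type_space_def intro!: exI[of _ 0])
    next
      fix x assume "x \<in> {x \<in> pts (type_space sc). vnorm (type_space sc) x \<le> 1}"
      then have x: "norm x \<le> 1" by (simp add: type_space_def)
      have "(\<lambda>t. T (sc (e t) x)) = (\<lambda>t. sc (e t) (T x))" by (simp add: bounded_operatorD[OF T])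
      then have "norm (T x) = vnorm E_X (lift_operator T (cls (\<lambda>t. sc (e t) x)))"
        using e by (simp add: lift_operator_cls vnorm_cls)
      also have "\<dots> \<le> operator_norm E_X (lift_operator T)"
        unfolding operator_norm_def[of E_X]
      proof (rule cSUP_upper)
        show "cls (\<lambda>t. sc (e t) x) \<in> {x \<in> pts E_X. vnorm E_X x \<le> 1}"
          using e x by (auto simp: pts_E_X vnorm_cls)
        show "bdd_above ((\<lambda>x. vnorm E_X (lift_operator T x)) ` {x \<in> pts E_X. vnorm E_X x \<le> 1})"
          using le by (intro bdd_aboveI2) auto
      qed
      finally show "vnorm (type_space sc) (T x) \<le> operator_norm E_X (lift_operator T)"
        by (simp add: type_space_def)
    qed
  qed
qed

text \<open>Lumer's estimate holds at every point, and the norm of \<open>E\<close> is monotone.\<close>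

lemma vnorm_perturbed_lift_operator_le:
  assumes states: "\<And>x. norm x = 1 \<Longrightarrow> \<exists>\<phi>. (x, \<phi>) \<in> state_pairs (type_space sc)"
    and c: "norm c * numerical_radius (type_space sc) T < 1" and x: "x \<in> pts E_X"
  shows "(1 - norm c * numerical_radius (type_space sc) T)
      * vnorm E_X (vadd E_X x (vscale E_X c (lift_operator T x)))
    \<le> (1 + (norm c * operator_norm (type_space sc) T)\<^sup>2) * vnorm E_X x"
proof -
  obtain f where f: "f \<in> F" "x = cls f" using x by (auto simp: pts_E_X)
  let ?d = "1 - norm c * numerical_radius (type_space sc) T"
  let ?u = "1 + (norm c * operator_norm (type_space sc) T)\<^sup>2"
  have "norm (f t + sc c (T (f t))) \<le> ?u / ?d * norm (f t)" for t
    using norm_perturbed_identity_le[OF T states, of c "f t"] c by (simp add: field_simps)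
  then have "N (\<lambda>t. norm (f t + sc c (T (f t)))) \<le> ?u / ?d * N (\<lambda>t. norm (f t))"
    using f c by (intro N_norm_mono_scaled) (auto simp: E_X_simps operator_fns)
  then show ?thesis
    using f c by (simp add: E_X_simps lift_operator_cls operator_fns field_simps)
qed

text \<open>
  A state gives \<open>1 + a \<bar>\<phi>(S x)\<bar> \<le> \<parallel>x + c S x\<parallel>\<close> for suitable \<open>c\<close> of modulus \<open>a\<close>, whereas Lumer's
  estimate bounds the right-hand side by \<open>1 + a v(T) + O(a\<^sup>2)\<close>.
\<close>

lemma norm_state_lift_operator_le:
  assumes states: "\<And>x. norm x = 1 \<Longrightarrow> \<exists>\<phi>. (x, \<phi>) \<in> state_pairs (type_space sc)"
    and K: "0 \<le> operator_norm (type_space sc) T"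
    and w: "0 \<le> numerical_radius (type_space sc) T"
    and s: "(x, \<phi>) \<in> state_pairs E_X"
  shows "norm (\<phi> (lift_operator T x)) \<le> numerical_radius (type_space sc) T"
proof (rule ccontr)
  interpret E_X: seminormed_space E_X by (rule seminormed_space_E_X)
  let ?w = "numerical_radius (type_space sc) T" and ?K = "operator_norm (type_space sc) T"
  define z where "z = \<phi> (lift_operator T x)"
  assume "\<not> norm (\<phi> (lift_operator T x)) \<le> ?w"
  then have gap: "?w < norm z" by (simp add: z_def)
  have x: "x \<in> pts E_X" "vnorm E_X x = 1" using s by (auto simp: state_pairs_def)
  have Tx: "lift_operator T x \<in> pts E_X"
    using lift_operator_bounded[OF K] x by (simp add: bounded_operators_def)
  \<comment> \<open>\<open>D\<close> bounds the second-order terms; \<open>a < 1 / (v(T) + 1)\<close> keeps \<open>1 - a v(T)\<close> positive.\<close>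
  define D where "D = ?K\<^sup>2 + norm z * ?w + 1"
  define m where "m = min ((norm z - ?w) / D) (1 / (?w + 1))"
  define a where "a = m / 2"
  have D: "0 < D" using w by (simp add: D_def add_nonneg_pos)
  have m: "0 < m" "m \<le> (norm z - ?w) / D" "m \<le> 1 / (?w + 1)" using gap D w by (auto simp: m_def)
  have a: "0 < a" "a < (norm z - ?w) / D" "a < 1 / (?w + 1)"
    unfolding a_def using m by linarith+
  \<comment> \<open>\<open>c\<close> turns \<open>z\<close> to the positive half-line, so that nothing is lost in \<open>\<bar>1 + c z\<bar>\<close>.\<close>
  define c where "c = of_real (a * norm z) / z"
  have c: "norm c = a" "c * z = of_real (a * norm z)"
    using gap w a(1) by (auto simp: c_def norm_divide norm_mult)
  have aw: "a * ?w < 1" using a(1,3) w by (simp add: field_simps)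
  have "\<phi> (vadd E_X x (vscale E_X c (lift_operator T x))) = of_real (1 + a * norm z)"
    using s x Tx c(2) by (simp add: state_pairs_def dual_space_def E_X.vscale_closed z_def)
  then have "1 + a * norm z = norm (\<phi> (vadd E_X x (vscale E_X c (lift_operator T x))))"
    using a(1) by (simp only: norm_of_real) simp
  also have "\<dots> \<le> vnorm E_X (vadd E_X x (vscale E_X c (lift_operator T x)))"
    using x Tx by (intro E_X.state_le_vnorm[OF s]) (simp add: E_X.vadd_closed E_X.vscale_closed)
  finally have "(1 - a * ?w) * (1 + a * norm z)
      \<le> (1 - a * ?w) * vnorm E_X (vadd E_X x (vscale E_X c (lift_operator T x)))"
    using aw by (intro mult_left_mono) auto
  also have "\<dots> \<le> 1 + (a * ?K)\<^sup>2"
    using vnorm_perturbed_lift_operator_le[OF states, of c x] c(1) aw x by simp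
  finally have "a * (norm z - ?w) \<le> a * (a * (?K\<^sup>2 + norm z * ?w))"
    by (simp add: algebra_simps power2_eq_square)
  then have "norm z - ?w \<le> a * (?K\<^sup>2 + norm z * ?w)" using a(1) by simp
  also have "\<dots> \<le> a * D" using a(1) by (simp add: D_def)
  also have "\<dots> < norm z - ?w" using a(2) D by (simp add: field_simps)
  finally show False by simp
qed

end

theorem numerical_index_le:
  assumes states: "\<And>x. norm x = 1 \<Longrightarrow> \<exists>\<phi>. (x, \<phi>) \<in> state_pairs (type_space sc)"
    and states_E_X: "\<And>x. x \<in> pts E_X \<Longrightarrow> vnorm E_X x = 1 \<Longrightarrow> \<exists>\<phi>. (x, \<phi>) \<in> state_pairs E_X"
    and nontrivial: "\<exists>x::'a. x \<noteq> 0"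
  shows "numerical_index E_X \<le> numerical_index (type_space sc)"
proof -
  interpret X: seminormed_space "type_space sc" by (rule seminormed_space_type_space)
  interpret E_X: seminormed_space E_X by (rule seminormed_space_E_X)
  obtain x :: 'a where x: "norm x = 1"
  proof -
    obtain x :: 'a where "x \<noteq> 0" using nontrivial by blast
    then have "norm (sc (of_real (inverse (norm x))) x) = 1" by (simp add: norm_sc norm_inverse)
    then show ?thesis by (rule that)
  qed
  obtain e where e: "\<And>x. (\<lambda>t. sc (e t) x) \<in> F" "\<And>x. N (\<lambda>t. norm (sc (e t) x)) = norm x"
    using isometric_copy by metis
  have "cls (\<lambda>t. sc (e t) x) \<in> pts E_X" "vnorm E_X (cls (\<lambda>t. sc (e t) x)) = 1"
    using e x by (auto simp: pts_E_X vnorm_cls)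
  then have ne_E_X: "state_pairs E_X \<noteq> {}" using states_E_X by blast
  have ne: "state_pairs (type_space sc) \<noteq> {}" using states[OF x] by blast
  show ?thesis
    unfolding numerical_index_def[of "type_space sc"]
  proof (rule cINF_greatest)
    have "operator_norm (type_space sc) id = 1"
      unfolding operator_norm_def
    proof (rule cSup_eq_maximum)
      show "1 \<in> (\<lambda>x. vnorm (type_space sc) (id x)) `
          {x \<in> pts (type_space sc). vnorm (type_space sc) x \<le> 1}"
        using x by (intro image_eqI[of _ _ x]) (auto simp: type_space_def)
    qed auto
    moreover have "id \<in> bounded_operators (type_space sc)"
      by (auto simp: bounded_operators_def intro!: exI[of _ 1])
    ultimately show
      "{T \<in> bounded_operators (type_space sc). operator_norm (type_space sc) T = 1} \<noteq> {}"
      by blast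
  next
    fix T assume "T \<in> {T \<in> bounded_operators (type_space sc). operator_norm (type_space sc) T = 1}"
    then have T: "T \<in> bounded_operators (type_space sc)" "operator_norm (type_space sc) T = 1"
      by auto
    have K: "0 \<le> operator_norm (type_space sc) T" using T(2) by simp
    have "numerical_index E_X \<le> numerical_radius E_X (lift_operator T)"
      unfolding numerical_index_def
    proof (rule cINF_lower)
      show "bdd_below (numerical_radius E_X ` {T \<in> bounded_operators E_X. operator_norm E_X T = 1})"
        using E_X.numerical_radius_nonneg ne_E_X by (intro bdd_belowI2[of _ 0]) auto
      show "lift_operator T \<in> {T \<in> bounded_operators E_X. operator_norm E_X T = 1}"
        using T lift_operator_bounded[OF T(1) K] operator_norm_lift_operator[OF T(1) K] by simp
    qed
    also have "\<dots> \<le> numerical_radius (type_space sc) T"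
      unfolding numerical_radius_def[of E_X]
      using norm_state_lift_operator_le[OF T(1) states K X.numerical_radius_nonneg[OF T(1) ne]]
      by (intro cSUP_least[OF ne_E_X]) auto
    finally show "numerical_index E_X \<le> numerical_radius (type_space sc) T" .
  qed
qed

end


section \<open>The inequality for real and complex Banach spaces\<close>

lemma (in sigma_finite_measure) finite_positive_set_exists:
  assumes "0 < emeasure M (space M)"
  shows "\<exists>A\<in>sets M. 0 < emeasure M A \<and> emeasure M A < \<infinity>"
proof (rule ccontr)
  assume *: "\<not> ?thesis"
  obtain A :: "nat \<Rightarrow> 'a set"
    where A: "range A \<subseteq> sets M" "(\<Union>i. A i) = space M" "\<And>i. emeasure M (A i) \<noteq> \<infinity>"
    using sigma_finite by blast
  have "A i \<in> null_sets M" for i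
    using * A(1) A(3)[of i] by (auto simp: null_sets_def less_top zero_less_iff_neq_zero)
  then have "space M \<in> null_sets M" unfolding A(2)[symmetric] by (rule null_sets_UN)
  then show False using assms by auto
qed

theorem corollary4p2:
  fixes M :: "'w measure" and E :: "('w \<Rightarrow> real) set" and N :: "('w \<Rightarrow> real) \<Rightarrow> real"
  assumes "complete_measure M" and "sigma_finite_measure M" and "emeasure M (space M) > 0"
    and "koethe_function_space M E N" and "order_continuous M E N"
  shows "((\<exists>x::'a::banach. x \<noteq> 0) \<longrightarrow>
       numerical_index (koethe_bochner_space M E N (scaleR :: real \<Rightarrow> 'a \<Rightarrow> 'a))
         \<le> numerical_index (type_space (scaleR :: real \<Rightarrow> 'a \<Rightarrow> 'a)))
    \<and> (\<forall>sc :: complex \<Rightarrow> 'b::banach \<Rightarrow> 'b. complex_banach sc \<longrightarrow> (\<exists>x::'b. x \<noteq> 0) \<longrightarrow>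
       numerical_index (koethe_bochner_space M E N sc) \<le> numerical_index (type_space sc))"
proof (intro conjI impI allI)
  note A = sigma_finite_measure.finite_positive_set_exists[OF assms(2,3)]
  note E_X = koethe_bochner.intro[OF assms(4) _ koethe_bochner_axioms.intro[OF assms(1) A]]
  show "numerical_index (koethe_bochner_space M E N (scaleR :: real \<Rightarrow> 'a \<Rightarrow> 'a))
         \<le> numerical_index (type_space (scaleR :: real \<Rightarrow> 'a \<Rightarrow> 'a))"
    if nontrivial: "\<exists>x::'a. x \<noteq> 0"
  proof -
    have "normed_scaling (scaleR :: real \<Rightarrow> 'a \<Rightarrow> 'a)"
      by unfold_locales (auto simp: algebra_simps)
    then interpret koethe_bochner M E N "scaleR :: real \<Rightarrow> 'a \<Rightarrow> 'a" by (rule E_X)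
    show ?thesis
      using state_exists_real[OF seminormed_space_type_space]
        state_exists_real[OF seminormed_space_E_X] nontrivial
      by (intro numerical_index_le) (auto simp: type_space_def)
  qed
  fix sc :: "complex \<Rightarrow> 'b \<Rightarrow> 'b"
  assume sc: "complex_banach sc" and nontrivial: "\<exists>x::'b. x \<noteq> 0"
  have "normed_scaling sc"
    using sc by (intro normed_scaling.intro normed_scaling_axioms.intro)
      (auto simp: complex_banach_def complex_banach_axioms_def)
  then interpret koethe_bochner M E N sc by (rule E_X)
  show "numerical_index (koethe_bochner_space M E N sc) \<le> numerical_index (type_space sc)"
    using state_exists_complex[OF seminormed_space_type_space]
      state_exists_complex[OF seminormed_space_E_X] nontrivial
    by (intro numerical_index_le) (auto simp: type_space_def)
qed

end
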